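(* Let $p,q\ge 0$ be integers and let $a_1,\dots,a_p,b_1,\dots,b_q$ be arbitrary constants. For every integer $N\ge 0$ put $$F_N(x)={}_{p+N+1}F_{q+N+1}\Bigl(a_1,\dots,a_p,\tfrac{\alpha+1}{\gamma},\tfrac{\alpha+\beta+1}{\gamma},\dots,\tfrac{\alpha+N\beta+1}{\gamma};\,b_1,\dots,b_q,\tfrac{\alpha+\gamma+1}{\gamma},\tfrac{\alpha+\gamma+\beta+1}{\gamma},\dots,\tfrac{\alpha+\gamma+N\beta+1}{\gamma};\,\lambda x^{\gamma}\Bigr).$$ Then, for any constants $\alpha,\beta,\eta,\lambda$ and any nonzero constant $\gamma$, $$\sin(\eta x^\beta)\sum_{j=0}^{\infty}\frac{(-1)^j(\beta\eta x^\beta)^{2j}}{\prod_{m=0}^{2j}(\alpha+m\beta+1)}F_{2j}(x)-\cos(\eta x^\beta)\sum_{j=0}^{\infty}\frac{(-1)^j(\beta\eta x^\beta)^{2j+1}}{\prod_{m=0}^{2j+1}(\alpha+m\beta+1)}F_{2j+1}(x)$$ $$=\frac1{2i}\left[e^{i\eta x^\beta}\sum_{j=0}^{\infty}\frac{(-i\beta\eta x^\beta)^{j}}{\prod_{m=0}^{j}(\alpha+m\beta+1)}F_{j}(x)-e^{-i\eta x^\beta}\sum_{j=0}^{\infty}\frac{(i\beta\eta x^\beta)^{j}}{\prod_{m=0}^{j}(\alpha+m\beta+1)}F_{j}(x)\right].$$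
   Context: Constants are real or complex; $i$ is the imaginary unit. The generalized hypergeometric function is defined by the series $${}_pF_q(a_1,\dots,a_p;b_1,\dots,b_q;x)=\sum_{n=0}^{\infty}\frac{(a_1)_n\cdots(a_p)_n}{(b_1)_n\cdots(b_q)_n}\frac{x^n}{n!},$$ with Pochhammer symbol $(\vartheta)_n=\Gamma(\vartheta+n)/\Gamma(\vartheta)$, $(\vartheta)_0=1$. *)

theory Defs
  imports "HOL-Analysis.Analysis"
begin

text \<open>
  The lists hold the upper and the lower parameters, so \<open>p\<close> and \<open>q\<close> are their lengths.
\<close>
definition pFq :: "complex list \<Rightarrow> complex list \<Rightarrow> complex \<Rightarrow> complex" where
  "pFq as bs x = eval_fps (fps_hypergeo as bs 1) x"

lemma foldl_mult_eq_prod_list: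
  "foldl (\<lambda>r a. r * f a) c as = c * (\<Prod>a\<leftarrow>as. f a :: 'a :: comm_monoid_mult)"
  by (induction as arbitrary: c) (simp_all add: mult.assoc)

lemma pFq_series:
  "pFq as bs x = (\<Sum>n. (\<Prod>a\<leftarrow>as. pochhammer a n) / (\<Prod>b\<leftarrow>bs. pochhammer b n) * (x ^ n / fact n))"
  by (simp add: pFq_def eval_fps_def foldl_mult_eq_prod_list)

text \<open>
  Complex powers of the variable are taken with the principal branch.
\<close>
definition F ::
  "complex list \<Rightarrow> complex list \<Rightarrow> complex \<Rightarrow> complex \<Rightarrow> complex \<Rightarrow> complex \<Rightarrow> nat \<Rightarrow> complex \<Rightarrow> complex" where
  "F as bs \<alpha> \<beta> \<gamma> lam N x =
     pFq (as @ map (\<lambda>m. (\<alpha> + of_nat m * \<beta> + 1) / \<gamma>) [0..<N + 1])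
         (bs @ map (\<lambda>m. (\<alpha> + \<gamma> + of_nat m * \<beta> + 1) / \<gamma>) [0..<N + 1])
         (lam * x powr \<gamma>)"

end

theory Submission
  imports Defs
begin

text \<open>
  The identity does not depend on the hypergeometric functions. Write \<open>c j\<close> for the common
  factor \<open>(\<beta> * \<eta> * x powr \<beta>) ^ j / (\<Prod>m=0..j. \<alpha> + of_nat m * \<beta> + 1) * F j x\<close>. The exponential side
  uses the series of \<open>(\<mp>\<i>) ^ j * c j\<close>, and the trigonometric side uses the series \<open>S\<close> of
  \<open>(-1) ^ j * c (2 * j)\<close> and \<open>T\<close> of \<open>(-1) ^ j * c (2 * j + 1)\<close>. As \<open>\<iota> ^ 2 = -1\<close> for \<open>\<iota> = \<plusminus>\<i>\<close>,
  sorting the terms by the parity of \<open>j\<close> gives \<open>S + \<iota> * T\<close> as the sum of \<open>\<iota> ^ j * c j\<close>, and Euler's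
  formula turns \<open>(exp (\<i> * t) * (S - \<i> * T) - exp (-\<i> * t) * (S + \<i> * T)) / (2 * \<i>)\<close> into
  \<open>sin t * S - cos t * T\<close>.

  The convergence of these series may be only conditional, so the terms cannot be regrouped at will.
  Each of the two halves is therefore padded with zeros to a series over all indices: padding with zeros
  changes neither convergence nor sum, and the padded halves are linear combinations of the two
  exponential series and conversely (\<open>sums_imaginary_powers\<close> and \<open>sums_halves_of_imaginary_powers\<close>).
\<close>

lemma sums_even_terms_iff:
  fixes f :: "nat \<Rightarrow> 'a :: real_normed_vector"
  shows "(\<lambda>j. f (2 * j)) sums s \<longleftrightarrow> (\<lambda>n. if even n then f n else 0) sums s"
proof -
  have "(\<lambda>j. (\<lambda>n. if even n then f n else 0) (2 * j)) sums s
          \<longleftrightarrow> (\<lambda>n. if even n then f n else 0) sums s"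
    by (rule sums_mono_reindex) (auto simp: strict_mono_def elim!: evenE)
  then show ?thesis by simp
qed

lemma sums_odd_terms_iff:
  fixes f :: "nat \<Rightarrow> 'a :: real_normed_vector"
  shows "(\<lambda>j. f (2 * j + 1)) sums s \<longleftrightarrow> (\<lambda>n. if odd n then f n else 0) sums s"
proof -
  have "(\<lambda>j. (\<lambda>n. if odd n then f n else 0) (2 * j + 1)) sums s
          \<longleftrightarrow> (\<lambda>n. if odd n then f n else 0) sums s"
    by (rule sums_mono_reindex) (auto simp: strict_mono_def elim!: oddE)
  then show ?thesis by simp
qed

text \<open>
  The parameter \<open>\<iota>\<close> stands for either square root of \<open>-1\<close>, so that one argument serves both
  exponential series.
\<close>

lemma sums_imaginary_powers:
  fixes c :: "nat \<Rightarrow> complex"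
  assumes "\<iota> ^ 2 = -1"
    and S: "(\<lambda>j. (-1) ^ j * c (2 * j)) sums S"
    and T: "(\<lambda>j. (-1) ^ j * c (2 * j + 1)) sums T"
  shows "(\<lambda>j. \<iota> ^ j * c j) sums (S + \<iota> * T)"
proof -
  have "(\<lambda>j. \<iota> ^ (2 * j) * c (2 * j)) sums S"
    using S assms(1) by (simp add: power_mult)
  moreover have "(\<lambda>j. \<iota> ^ (2 * j + 1) * c (2 * j + 1)) sums (\<iota> * T)"
    using sums_mult[OF T, of \<iota>] by (simp add: power_mult assms(1) mult.assoc)
  ultimately have "(\<lambda>n. (if even n then \<iota> ^ n * c n else 0) + (if odd n then \<iota> ^ n * c n else 0))
                     sums (S + \<iota> * T)"
    using sums_even_terms_iff[of "\<lambda>n. \<iota> ^ n * c n"] sums_odd_terms_iff[of "\<lambda>n. \<iota> ^ n * c n"]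
    by (intro sums_add) auto
  also have "(\<lambda>n. (if even n then \<iota> ^ n * c n else 0) + (if odd n then \<iota> ^ n * c n else 0))
               = (\<lambda>n. \<iota> ^ n * c n)"
    by auto
  finally show ?thesis .
qed

text \<open>
  Convergence of one exponential series alone does not make its two halves converge. With both series, half their sum and half their difference, the latter divided by \<open>\<i>\<close>, are the padded halves.
\<close>

lemma sums_halves_of_imaginary_powers:
  fixes c :: "nat \<Rightarrow> complex"
  assumes P: "(\<lambda>j. \<i> ^ j * c j) sums P"
    and M: "(\<lambda>j. (-\<i>) ^ j * c j) sums M"
  shows "(\<lambda>j. (-1) ^ j * c (2 * j)) sums ((P + M) / 2)"
    and "(\<lambda>j. (-1) ^ j * c (2 * j + 1)) sums ((P - M) / (2 * \<i>))"
proof -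
  have "(\<lambda>n. (\<i> ^ n * c n + (-\<i>) ^ n * c n) / 2) sums ((P + M) / 2)"
    by (intro sums_divide sums_add P M)
  also have "(\<lambda>n. (\<i> ^ n * c n + (-\<i>) ^ n * c n) / 2) = (\<lambda>n. if even n then \<i> ^ n * c n else 0)"
    by auto
  finally have "(\<lambda>j. \<i> ^ (2 * j) * c (2 * j)) sums ((P + M) / 2)"
    by (subst sums_even_terms_iff[of "\<lambda>n. \<i> ^ n * c n"])
  then show "(\<lambda>j. (-1) ^ j * c (2 * j)) sums ((P + M) / 2)"
    by (simp add: power_mult)
  have "(\<lambda>n. (\<i> ^ n * c n - (-\<i>) ^ n * c n) / (2 * \<i>)) sums ((P - M) / (2 * \<i>))"
    by (intro sums_divide sums_diff P M)
  also have "(\<lambda>n. (\<i> ^ n * c n - (-\<i>) ^ n * c n) / (2 * \<i>))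
               = (\<lambda>n. if odd n then \<i> ^ n * c n / \<i> else 0)"
    by auto
  finally have "(\<lambda>j. \<i> ^ (2 * j + 1) * c (2 * j + 1) / \<i>) sums ((P - M) / (2 * \<i>))"
    by (subst sums_odd_terms_iff[of "\<lambda>n. \<i> ^ n * c n / \<i>"])
  moreover have "\<i> ^ (2 * j + 1) * c (2 * j + 1) / \<i> = (-1) ^ j * c (2 * j + 1)" for j
    by (simp add: power_mult mult.assoc[symmetric])
  ultimately show "(\<lambda>j. (-1) ^ j * c (2 * j + 1)) sums ((P - M) / (2 * \<i>))"
    by (simp only:)
qed

lemma summable_halves_iff_imaginary_powers:
  fixes c :: "nat \<Rightarrow> complex"
  shows "summable (\<lambda>j. (-1) ^ j * c (2 * j)) \<and> summable (\<lambda>j. (-1) ^ j * c (2 * j + 1))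
           \<longleftrightarrow> summable (\<lambda>j. (-\<i>) ^ j * c j) \<and> summable (\<lambda>j. \<i> ^ j * c j)"
proof (intro iffI conjI; elim conjE)
  assume "summable (\<lambda>j. (-1) ^ j * c (2 * j))" "summable (\<lambda>j. (-1) ^ j * c (2 * j + 1))"
  then obtain S T where "(\<lambda>j. (-1) ^ j * c (2 * j)) sums S" "(\<lambda>j. (-1) ^ j * c (2 * j + 1)) sums T"
    unfolding summable_def by blast
  then have "(\<lambda>j. \<iota> ^ j * c j) sums (S + \<iota> * T)" if "\<iota> ^ 2 = -1" for \<iota>
    using sums_imaginary_powers that by blast
  from this[of "-\<i>"] this[of \<i>]
  show "summable (\<lambda>j. (-\<i>) ^ j * c j)" "summable (\<lambda>j. \<i> ^ j * c j)"
    by (simp_all add: sums_summable)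
next
  assume "summable (\<lambda>j. (-\<i>) ^ j * c j)" "summable (\<lambda>j. \<i> ^ j * c j)"
  then obtain P M where "(\<lambda>j. \<i> ^ j * c j) sums P" "(\<lambda>j. (-\<i>) ^ j * c j) sums M"
    unfolding summable_def by blast
  note halves = sums_halves_of_imaginary_powers[OF this]
  show "summable (\<lambda>j. (-1) ^ j * c (2 * j))" "summable (\<lambda>j. (-1) ^ j * c (2 * j + 1))"
    by (rule halves[THEN sums_summable])+
qed

lemma Euler_sin_cos_combination:
  fixes S T t :: complex
  shows "sin t * S - cos t * T
           = 1 / (2 * \<i>) * (exp (\<i> * t) * (S - \<i> * T) - exp (- (\<i> * t)) * (S + \<i> * T))"
  by (simp add: sin_exp_eq cos_exp_eq field_simps)

theorem theorem5:
  fixes as bs :: "complex list" and \<alpha> \<beta> \<gamma> \<eta> lam x :: complex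
  assumes "\<gamma> \<noteq> 0"
  shows
    "let s_even = (\<lambda>j. (-1) ^ j * (\<beta> * \<eta> * x powr \<beta>) ^ (2 * j)
                     / (\<Prod>m=0..2 * j. (\<alpha> + of_nat m * \<beta> + 1)) * F as bs \<alpha> \<beta> \<gamma> lam (2 * j) x);
         s_odd = (\<lambda>j. (-1) ^ j * (\<beta> * \<eta> * x powr \<beta>) ^ (2 * j + 1)
                     / (\<Prod>m=0..2 * j + 1. (\<alpha> + of_nat m * \<beta> + 1)) * F as bs \<alpha> \<beta> \<gamma> lam (2 * j + 1) x);
         s_minus = (\<lambda>j. (- \<i> * \<beta> * \<eta> * x powr \<beta>) ^ j
                     / (\<Prod>m=0..j. (\<alpha> + of_nat m * \<beta> + 1)) * F as bs \<alpha> \<beta> \<gamma> lam j x);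
         s_plus = (\<lambda>j. (\<i> * \<beta> * \<eta> * x powr \<beta>) ^ j
                     / (\<Prod>m=0..j. (\<alpha> + of_nat m * \<beta> + 1)) * F as bs \<alpha> \<beta> \<gamma> lam j x)
     in (summable s_even \<and> summable s_odd \<longleftrightarrow> summable s_minus \<and> summable s_plus) \<and>
        (summable s_even \<and> summable s_odd \<longrightarrow>
           sin (\<eta> * x powr \<beta>) * (\<Sum>j. s_even j) - cos (\<eta> * x powr \<beta>) * (\<Sum>j. s_odd j)
           = 1 / (2 * \<i>) * (exp (\<i> * \<eta> * x powr \<beta>) * (\<Sum>j. s_minus j)
                            - exp (- \<i> * \<eta> * x powr \<beta>) * (\<Sum>j. s_plus j)))"
proof -
  define w where "w = \<beta> * \<eta> * x powr \<beta>"
  define c where "c j = w ^ j / (\<Prod>m=0..j. (\<alpha> + of_nat m * \<beta> + 1)) * F as bs \<alpha> \<beta> \<gamma> lam j x" for j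
  have even: "(-1) ^ j * (\<beta> * \<eta> * x powr \<beta>) ^ (2 * j) / (\<Prod>m=0..2 * j. (\<alpha> + of_nat m * \<beta> + 1))
                * F as bs \<alpha> \<beta> \<gamma> lam (2 * j) x = (-1) ^ j * c (2 * j)" for j
    by (simp add: c_def w_def)
  have odd: "(-1) ^ j * (\<beta> * \<eta> * x powr \<beta>) ^ (2 * j + 1) / (\<Prod>m=0..2 * j + 1. (\<alpha> + of_nat m * \<beta> + 1))
               * F as bs \<alpha> \<beta> \<gamma> lam (2 * j + 1) x = (-1) ^ j * c (2 * j + 1)" for j
    unfolding c_def w_def by (simp only: times_divide_eq_right times_divide_eq_left mult.assoc)
  have minus_w: "- \<i> * \<beta> * \<eta> * x powr \<beta> = - \<i> * w" and plus_w: "\<i> * \<beta> * \<eta> * x powr \<beta> = \<i> * w"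
    by (simp_all add: w_def)
  have pow: "(u * w) ^ j / (\<Prod>m=0..j. (\<alpha> + of_nat m * \<beta> + 1)) * F as bs \<alpha> \<beta> \<gamma> lam j x = u ^ j * c j"
    for u j
    by (simp add: c_def power_mult_distrib)
  have exp_args: "\<i> * \<eta> * x powr \<beta> = \<i> * (\<eta> * x powr \<beta>)" "- \<i> * \<eta> * x powr \<beta> = - (\<i> * (\<eta> * x powr \<beta>))"
    by simp_all
  have identity: "sin (\<eta> * x powr \<beta>) * (\<Sum>j. (-1) ^ j * c (2 * j))
          - cos (\<eta> * x powr \<beta>) * (\<Sum>j. (-1) ^ j * c (2 * j + 1))
        = 1 / (2 * \<i>) * (exp (\<i> * (\<eta> * x powr \<beta>)) * (\<Sum>j. (-\<i>) ^ j * c j)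
            - exp (- (\<i> * (\<eta> * x powr \<beta>))) * (\<Sum>j. \<i> ^ j * c j))"
    if "summable (\<lambda>j. (-1) ^ j * c (2 * j)) \<and> summable (\<lambda>j. (-1) ^ j * c (2 * j + 1))"
  proof -
    define S T where "S = (\<Sum>j. (-1) ^ j * c (2 * j))" and "T = (\<Sum>j. (-1) ^ j * c (2 * j + 1))"
    have "(\<lambda>j. (-1) ^ j * c (2 * j)) sums S" "(\<lambda>j. (-1) ^ j * c (2 * j + 1)) sums T"
      using that by (auto simp: S_def T_def intro: summable_sums)
    then have "(\<lambda>j. \<i> ^ j * c j) sums (S + \<i> * T)" "(\<lambda>j. (-\<i>) ^ j * c j) sums (S + (-\<i>) * T)"
      by (intro sums_imaginary_powers; simp)+
    then have "(\<Sum>j. \<i> ^ j * c j) = S + \<i> * T" "(\<Sum>j. (-\<i>) ^ j * c j) = S - \<i> * T"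
      by (simp_all add: sums_iff)
    then show ?thesis
      unfolding S_def[symmetric] T_def[symmetric] by (simp only: Euler_sin_cos_combination)
  qed
  show ?thesis
    unfolding Let_def even odd minus_w plus_w pow exp_args
    using summable_halves_iff_imaginary_powers[of c] identity by blast
qed

end
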